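(* Let $X$ be a nonzero real Banach space. Then there exists a norm-one projection $$P_{ph}\colon\operatorname{Lip}_0(X)\longrightarrow\operatorname{Lip}_0^{ph}(X),$$ given, for an invariant mean $m$ on $\ell_\infty((0,\infty))$, by $$(P_{ph}f)(x)=m_r\left[r\mapsto r f\left(\frac{x}{r}\right)\right],\qquad f\in\operatorname{Lip}_0(X),\ x\in X.$$ Consequently, $\operatorname{Lip}_0^{ph}(X)$ is $1$-complemented in $\operatorname{Lip}_0(X)$.
   Context: $\operatorname{Lip}_0(X)$ is the Banach space of Lipschitz functions $f\colon X\to\mathbb R$ with $f(0)=0$, normed by the least Lipschitz constant $\operatorname{Lip}(f)$. $\operatorname{Lip}_0^{ph}(X)=\{f\in\operatorname{Lip}_0(X): f(rx)=rf(x)\text{ for every }r\ge0,\ x\in X\}$. The set $(0,\infty)$ is regarded as the (discrete, abelian) multiplicative group, $\ell_\infty((0,\infty))$ is the space of all bounded real functions on it with the supremum norm, and an invariant mean on it is a norm-one linear functional $m$ with $m(1)=1$ and $m(r\mapsto h(sr))=m(h)$ for all $s>0$ and $h\in\ell_\infty((0,\infty))$. The notation $m_r$ means that $m$ is applied to a bounded function of the variable $r$; here $|rf(x/r)|\le\operatorname{Lip}(f)\|x\|$. A subspace is $1$-complemented if it is the range of a projection of norm at most one. *)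

theory Defs
  imports "HOL-Analysis.Analysis"
begin

section \<open>The Banach space of Lipschitz functions vanishing at the origin\<close>

typedef (overloaded) 'a lip0 =
  "{f :: 'a::real_normed_vector \<Rightarrow> real. f 0 = 0 \<and> (\<exists>C. C-lipschitz_on UNIV f)}"
  morphisms lip0_apply Lip0
  by (rule exI[of _ "\<lambda>_. 0"]) (auto intro!: exI[of _ 0] lipschitz_onI)

declare [[coercion "lip0_apply :: 'a::real_normed_vector lip0 \<Rightarrow> 'a \<Rightarrow> real"]]

setup_lifting type_definition_lip0

lemma lip0_eqI: "(\<And>x. lip0_apply f x = lip0_apply g x) \<Longrightarrow> f = g"
  by transfer auto

lemma lip0_apply_zero [simp]: "lip0_apply f 0 = 0"
  by transfer simp

definition lip_const :: "('a::metric_space \<Rightarrow> real) \<Rightarrow> real" where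
  "lip_const f = Inf {C. C-lipschitz_on UNIV f}"

lemma bdd_below_lipschitz: "bdd_below {C. C-lipschitz_on UNIV f}"
  by (auto intro!: bdd_belowI[of _ 0] dest: lipschitz_on_nonneg)

text \<open>The infimum defining \<^const>\<open>lip_const\<close> is attained, so it is the least Lipschitz constant.\<close>

lemma lipschitz_on_lip_const:
  assumes "\<exists>C. C-lipschitz_on UNIV f"
  shows "(lip_const f)-lipschitz_on UNIV f"
proof (rule lipschitz_onI)
  have ne: "{C. C-lipschitz_on UNIV f} \<noteq> {}"
    using assms by auto
  show "0 \<le> lip_const f"
    unfolding lip_const_def by (rule cInf_greatest[OF ne]) (auto dest: lipschitz_on_nonneg)
  fix x y
  show "dist (f x) (f y) \<le> lip_const f * dist x y"
  proof (cases "x = y")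
    case False
    then have pos: "0 < dist x y"
      by simp
    have "dist (f x) (f y) / dist x y \<le> lip_const f"
      unfolding lip_const_def
      using pos by (intro cInf_greatest[OF ne]) (auto dest: lipschitz_onD simp: field_simps)
    then show ?thesis
      using pos by (simp add: field_simps)
  qed simp
qed

lemma lip_const_le: "C-lipschitz_on UNIV f \<Longrightarrow> lip_const f \<le> C"
  unfolding lip_const_def by (rule cInf_lower) (auto intro: bdd_below_lipschitz)

lemma lip_const_nonneg: "\<exists>C. C-lipschitz_on UNIV f \<Longrightarrow> 0 \<le> lip_const f"
  using lipschitz_on_lip_const lipschitz_on_nonneg by blast

lemma lipschitz_on_real_add:
  fixes f g :: "'a::metric_space \<Rightarrow> real"
  assumes "C-lipschitz_on UNIV f" "D-lipschitz_on UNIV g"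
  shows "(C + D)-lipschitz_on UNIV (\<lambda>x. f x + g x)"
  using assms by (rule lipschitz_on_add)

lemma lipschitz_on_real_scale:
  fixes f :: "'a::metric_space \<Rightarrow> real"
  assumes "C-lipschitz_on UNIV f"
  shows "(\<bar>a\<bar> * C)-lipschitz_on UNIV (\<lambda>x. a * f x)"
proof (rule lipschitz_onI)
  fix x y
  have "dist (a * f x) (a * f y) = \<bar>a\<bar> * dist (f x) (f y)"
    by (simp add: dist_real_def abs_mult flip: right_diff_distrib)
  also have "\<dots> \<le> \<bar>a\<bar> * (C * dist x y)"
    using lipschitz_onD[OF assms] by (intro mult_left_mono) auto
  finally show "dist (a * f x) (a * f y) \<le> \<bar>a\<bar> * C * dist x y"
    by (simp add: mult.assoc)
qed (use lipschitz_on_nonneg[OF assms] in simp)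

instantiation lip0 :: (real_normed_vector) real_normed_vector
begin

lift_definition zero_lip0 :: "'a lip0" is "\<lambda>_. 0"
  by (auto intro!: exI[of _ 0] lipschitz_onI)

lift_definition plus_lip0 :: "'a lip0 \<Rightarrow> 'a lip0 \<Rightarrow> 'a lip0" is "\<lambda>f g x. f x + g x"
  by (auto dest: lipschitz_on_real_add)

lift_definition scaleR_lip0 :: "real \<Rightarrow> 'a lip0 \<Rightarrow> 'a lip0" is "\<lambda>a f x. a * f x"
  by (auto dest: lipschitz_on_real_scale)

lift_definition uminus_lip0 :: "'a lip0 \<Rightarrow> 'a lip0" is "\<lambda>f x. - f x"
  by (auto dest: lipschitz_on_minus)

lift_definition minus_lip0 :: "'a lip0 \<Rightarrow> 'a lip0 \<Rightarrow> 'a lip0" is "\<lambda>f g x. f x - g x"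
  by (auto dest: lipschitz_on_diff)

lift_definition norm_lip0 :: "'a lip0 \<Rightarrow> real" is lip_const .

definition dist_lip0 :: "'a lip0 \<Rightarrow> 'a lip0 \<Rightarrow> real" where
  "dist_lip0 f g = norm (f - g)"

definition sgn_lip0 :: "'a lip0 \<Rightarrow> 'a lip0" where
  "sgn_lip0 f = scaleR (inverse (norm f)) f"

definition uniformity_lip0 :: "('a lip0 \<times> 'a lip0) filter" where
  "uniformity_lip0 = (INF e\<in>{0<..}. principal {(x, y). dist x y < e})"

definition open_lip0 :: "'a lip0 set \<Rightarrow> bool" where
  "open_lip0 S = (\<forall>x\<in>S. \<forall>\<^sub>F (x', y) in uniformity. x' = x \<longrightarrow> y \<in> S)"

instance
proof
  fix f g :: "'a lip0" and a :: real
  show "norm f = 0 \<longleftrightarrow> f = 0"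
  proof transfer
    fix f :: "'a \<Rightarrow> real"
    assume f: "f 0 = 0 \<and> (\<exists>C. C-lipschitz_on UNIV f)"
    show "lip_const f = 0 \<longleftrightarrow> f = (\<lambda>_. 0)"
    proof
      assume "lip_const f = 0"
      then have "0-lipschitz_on UNIV f"
        using f lipschitz_on_lip_const[of f] by simp
      then have "dist (f x) (f 0) \<le> 0" for x
        by (auto dest: lipschitz_onD)
      then show "f = (\<lambda>_. 0)"
        using f by auto
    next
      assume "f = (\<lambda>_. 0)"
      then have "0-lipschitz_on UNIV f"
        by (auto intro: lipschitz_onI)
      then show "lip_const f = 0"
        using lip_const_le lip_const_nonneg by (metis order_antisym)
    qed
  qed
  show "norm (f + g) \<le> norm f + norm g"
    by transfer (auto intro!: lip_const_le lipschitz_on_real_add lipschitz_on_lip_const)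
  have le: "norm (b *\<^sub>R h) \<le> \<bar>b\<bar> * norm h" for b and h :: "'a lip0"
    by transfer (auto intro!: lip_const_le lipschitz_on_real_scale lipschitz_on_lip_const)
  show "norm (a *\<^sub>R f) = \<bar>a\<bar> * norm f"
  proof (cases "a = 0")
    case True
    have "0 \<le> norm (a *\<^sub>R f)"
      by transfer (auto dest: lipschitz_on_real_scale intro!: lip_const_nonneg)
    with le[of a f] True show ?thesis by simp
  next
    case False
    have "inverse a *\<^sub>R (a *\<^sub>R f) = f"
      using False by transfer (auto simp: fun_eq_iff)
    with le[of "inverse a" "a *\<^sub>R f"] have "norm f \<le> inverse \<bar>a\<bar> * norm (a *\<^sub>R f)"
      by simp
    with False have "\<bar>a\<bar> * norm f \<le> norm (a *\<^sub>R f)"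
      by (simp add: field_simps)
    with le[of a f] show ?thesis by simp
  qed
qed (fact dist_lip0_def sgn_lip0_def uniformity_lip0_def open_lip0_def
     | (transfer, simp add: algebra_simps fun_eq_iff))+

end

declare zero_lip0.rep_eq [simp] plus_lip0.rep_eq [simp] scaleR_lip0.rep_eq [simp]
  uminus_lip0.rep_eq [simp] minus_lip0.rep_eq [simp]

lemma lipschitz_on_norm_lip0: "(norm f)-lipschitz_on UNIV (lip0_apply f)"
  by transfer (auto intro: lipschitz_on_lip_const)

lemma norm_lip0_le: "C-lipschitz_on UNIV (lip0_apply f) \<Longrightarrow> norm f \<le> C"
  by transfer (rule lip_const_le)

lemma abs_lip0_apply_le: "\<bar>lip0_apply f x\<bar> \<le> norm f * norm x"
  using lipschitz_onD[OF lipschitz_on_norm_lip0, of x 0 f] by simp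

instance lip0 :: (real_normed_vector) banach
proof
  fix F :: "nat \<Rightarrow> 'a lip0"
  assume F: "Cauchy F"
  have "Cauchy (\<lambda>n. F n x)" for x
  proof (rule metric_CauchyI)
    fix e :: real
    assume e: "0 < e"
    define d where "d = e / (norm x + 1)"
    have d: "0 < d"
      using e by (simp add: d_def add_nonneg_pos)
    obtain N where N: "\<And>m n. m \<ge> N \<Longrightarrow> n \<ge> N \<Longrightarrow> norm (F m - F n) < d"
      using metric_CauchyD[OF F d] unfolding dist_norm by meson
    have "dist (F m x) (F n x) < e" if "m \<ge> N" "n \<ge> N" for m n
    proof -
      have "dist (F m x) (F n x) \<le> norm (F m - F n) * norm x"
        using abs_lip0_apply_le[of "F m - F n" x] by (simp add: dist_real_def)
      also have "\<dots> \<le> d * norm x"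
        using N[OF that] by (intro mult_right_mono) auto
      also have "\<dots> < d * (norm x + 1)"
        using d by simp
      also have "\<dots> = e"
        using add_nonneg_pos[of "norm x" 1] by (simp add: d_def)
      finally show ?thesis .
    qed
    then show "\<exists>M. \<forall>m\<ge>M. \<forall>n\<ge>M. dist (F m x) (F n x) < e"
      by blast
  qed
  then have "(\<lambda>n. F n x) \<longlonglongrightarrow> lim (\<lambda>n. F n x)" for x
    using Cauchy_convergent convergent_LIMSEQ_iff by blast
  then obtain g where g: "\<And>x. (\<lambda>n. F n x) \<longlonglongrightarrow> g x"
    by (rule that[of "\<lambda>x. lim (\<lambda>n. F n x)"])
  have lim: "e-lipschitz_on UNIV (\<lambda>x. g x - F m x)"
    if e: "0 \<le> e" and N: "\<And>m n. m \<ge> N \<Longrightarrow> n \<ge> N \<Longrightarrow> norm (F m - F n) \<le> e" and m: "m \<ge> N"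
    for e N m
  proof (rule lipschitz_onI[OF _ e])
    fix x y
    have "(\<lambda>n. dist (F n x - F m x) (F n y - F m y)) \<longlonglongrightarrow> dist (g x - F m x) (g y - F m y)"
      by (intro tendsto_intros g)
    then show "dist (g x - F m x) (g y - F m y) \<le> e * dist x y"
    proof (rule tendsto_upperbound)
      show "\<forall>\<^sub>F n in sequentially. dist (F n x - F m x) (F n y - F m y) \<le> e * dist x y"
        using eventually_ge_at_top[of N]
      proof eventually_elim
        case (elim n)
        then show ?case
          using lipschitz_onD[OF lipschitz_on_le[OF lipschitz_on_norm_lip0 N[OF elim m]], of x y]
          by simp
      qed
    qed simp
  qed
  obtain N where N: "\<And>m n. m \<ge> N \<Longrightarrow> n \<ge> N \<Longrightarrow> norm (F m - F n) \<le> 1"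
    using metric_CauchyD[OF F zero_less_one] unfolding dist_norm by (meson less_imp_le)
  have "(1 + norm (F N))-lipschitz_on UNIV (\<lambda>x. g x - F N x + F N x)"
    by (rule lipschitz_on_add[OF lim[OF zero_le_one N order_refl] lipschitz_on_norm_lip0])
  then have "(1 + norm (F N))-lipschitz_on UNIV g"
    by simp
  moreover have "g 0 = 0"
    using LIMSEQ_unique[OF g[of 0], of 0] by simp
  ultimately have G: "lip0_apply (Lip0 g) = g"
    by (intro Lip0_inverse) blast
  define G where "G = Lip0 g"
  note G = G[folded G_def]
  have "F \<longlonglongrightarrow> G"
  proof (rule metric_LIMSEQ_I)
    fix e :: real
    assume "0 < e"
    then obtain N where N: "\<And>m n. m \<ge> N \<Longrightarrow> n \<ge> N \<Longrightarrow> norm (F m - F n) \<le> e / 2"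
      using metric_CauchyD[OF F, of "e / 2"] unfolding dist_norm by (meson half_gt_zero less_imp_le)
    have "dist (F m) G < e" if "m \<ge> N" for m
    proof -
      have "norm (G - F m) \<le> e / 2"
        using lim[OF _ N that] \<open>0 < e\<close> by (intro norm_lip0_le) (simp add: G)
      then show ?thesis
        using \<open>0 < e\<close> by (simp add: dist_norm norm_minus_commute)
    qed
    then show "\<exists>M. \<forall>m\<ge>M. dist (F m) G < e"
      by blast
  qed
  then show "convergent F"
    by (rule convergentI)
qed

definition lip0_ph :: "'a::real_normed_vector lip0 set" where
  "lip0_ph = {f. \<forall>r\<ge>0. \<forall>x. lip0_apply f (r *\<^sub>R x) = r * lip0_apply f x}"

lemma subspace_lip0_ph: "subspace lip0_ph"
  by (auto simp: subspace_def lip0_ph_def algebra_simps)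


section \<open>The discrete multiplicative group of positive reals and invariant means\<close>

typedef pos_real = "{0<..} :: real set"
  morphisms real_of_pos Pos
  by (rule exI[of _ 1]) simp

setup_lifting type_definition_pos_real

lemma real_of_pos_pos [simp]: "0 < real_of_pos r"
  by transfer simp

lemma real_of_pos_neq_0 [simp]: "real_of_pos r \<noteq> 0"
  by (metis real_of_pos_pos less_irrefl)

instantiation pos_real :: "{comm_monoid_mult, inverse}"
begin

lift_definition one_pos_real :: pos_real is 1
  by simp

lift_definition times_pos_real :: "pos_real \<Rightarrow> pos_real \<Rightarrow> pos_real" is "(*)"
  by simp

lift_definition inverse_pos_real :: "pos_real \<Rightarrow> pos_real" is inverse
  by simp

lift_definition divide_pos_real :: "pos_real \<Rightarrow> pos_real \<Rightarrow> pos_real" is "(/)"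
  by simp

instance
  by standard (transfer; simp)+

end

lemma pos_real_left_inverse [simp]: "inverse r * r = (1 :: pos_real)"
  by transfer simp

instantiation pos_real :: discrete_topology
begin

definition open_pos_real :: "pos_real set \<Rightarrow> bool" where
  "open_pos_real A \<longleftrightarrow> True"

instance
  by standard (auto simp: open_pos_real_def)

end

lifting_forget pos_real.lifting

text \<open>
  As \<^typ>\<open>pos_real\<close> is discrete, every function on it is continuous, so
  \<^typ>\<open>pos_real \<Rightarrow>\<^sub>C real\<close> is the space of all bounded real functions with the supremum norm.
\<close>

lemma bcontfun_pos_real_iff:
  "h \<in> bcontfun \<longleftrightarrow> bounded (range h)" for h :: "pos_real \<Rightarrow> real"
  by (auto simp: bcontfun_def continuous_on_open_vimage open_discrete)

context
  includes bcontfun.lifting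
begin

lift_definition translate :: "pos_real \<Rightarrow> (pos_real \<Rightarrow>\<^sub>C real) \<Rightarrow> (pos_real \<Rightarrow>\<^sub>C real)"
  is "\<lambda>s h r. h (s * r)"
  unfolding bcontfun_pos_real_iff by (erule bounded_subset) auto

lift_definition dilation_orbit :: "'a::real_normed_vector lip0 \<Rightarrow> 'a \<Rightarrow> (pos_real \<Rightarrow>\<^sub>C real)"
  is "\<lambda>f x r. real_of_pos r * lip0_apply f (x /\<^sub>R real_of_pos r)"
proof -
  fix f :: "'a lip0" and x :: 'a
  have "\<bar>real_of_pos r * f (x /\<^sub>R real_of_pos r)\<bar> \<le> norm f * norm x" for r
  proof -
    have "\<bar>real_of_pos r * f (x /\<^sub>R real_of_pos r)\<bar>
        \<le> real_of_pos r * (norm f * norm (x /\<^sub>R real_of_pos r))"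
      unfolding abs_mult using abs_lip0_apply_le[of f "x /\<^sub>R real_of_pos r"]
      by (intro mult_mono) (auto intro: less_imp_le)
    also have "\<dots> = norm f * norm x"
      by (simp add: abs_of_pos)
    finally show ?thesis .
  qed
  then show "(\<lambda>r. real_of_pos r * f (x /\<^sub>R real_of_pos r)) \<in> bcontfun"
    unfolding bcontfun_pos_real_iff by (intro boundedI) auto
qed

end

definition invariant_mean :: "((pos_real \<Rightarrow>\<^sub>C real) \<Rightarrow>\<^sub>L real) \<Rightarrow> bool" where
  "invariant_mean m \<longleftrightarrow>
     norm m = 1 \<and> m (const_bcontfun 1) = 1 \<and> (\<forall>s h. m (translate s h) = m h)"


section \<open>Projections\<close>

definition projection_onto :: "'b::real_normed_vector set \<Rightarrow> ('b \<Rightarrow>\<^sub>L 'b) \<Rightarrow> bool" where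
  "projection_onto Y P \<longleftrightarrow> P o\<^sub>L P = P \<and> range (blinfun_apply P) = Y"

definition one_complemented :: "'b::real_normed_vector set \<Rightarrow> bool" where
  "one_complemented Y \<longleftrightarrow> (\<exists>P. projection_onto Y P \<and> norm P \<le> 1)"

end

theory Submission
  imports Defs
begin

text \<open>
  An invariant mean exists because the multiplicative group of positive reals is abelian.
  Composing a mean with the average of the translates by \<open>1, s, \<dots>, s\<^sup>n\<^sup>-\<^sup>1\<close> makes it invariant under \<open>s\<close>
  up to an error \<open>2 / n\<close>; by commutativity this does not spoil the approximate invariance under other
  elements, so finitely many elements can be treated one after the other
  (\<open>almost_invariant_mean_exists\<close>). The unit ball of the dual space is weak-* compact
  (\<open>dual_ball_weak_star_cluster\<close>), and a cluster point of these approximate means, as the finite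
  set grows and the error shrinks, is an invariant mean (\<open>invariant_mean_exists\<close>).

  Fix an invariant mean \<open>m\<close> and write \<open>f\<^sub>r(x) = r f(x / r)\<close>. Each \<open>f\<^sub>r\<close> has the same Lipschitz
  constant as \<open>f\<close>, so their average with respect to \<open>m\<close> has no larger one
  (\<open>norm_dilation_mean_le\<close>). Replacing \<open>x\<close> by \<open>t x\<close> turns the function \<open>r \<mapsto> f\<^sub>r(x)\<close> into \<open>t\<close> times
  its translate by \<open>1 / t\<close> (\<open>dilation_orbit_scaleR\<close>), so invariance of \<open>m\<close> makes the average
  positively homogeneous. If \<open>f\<close> is positively homogeneous already, all the \<open>f\<^sub>r\<close> coincide with \<open>f\<close>
  and averaging does nothing. Thus averaging is a projection of norm at most one onto the positively
  homogeneous functions. Its norm is one because it fixes the function \<open>norm\<close>, which is not the zero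
  function on a nonzero space.
\<close>

section \<open>Weak-* compactness of the dual unit ball\<close>

text \<open>
  This is the Banach-Alaoglu theorem in filter form. Regarded as functions, the functionals of norm at
  most one lie in a product of compact intervals, so Tychonoff's theorem gives a cluster point, and
  linearity survives pointwise limits. A finer filter \<open>G\<close> along which there is convergence takes the
  place of a subnet.
\<close>

lemma dual_ball_weak_star_cluster:
  fixes \<phi> :: "'i \<Rightarrow> ('b::real_normed_vector \<Rightarrow>\<^sub>L real)"
  assumes "F \<noteq> bot" and bound: "eventually (\<lambda>i. norm (\<phi> i) \<le> 1) F"
  obtains m G where "G \<noteq> bot" "G \<le> F" "norm m \<le> 1"
    "\<And>h. ((\<lambda>i. blinfun_apply (\<phi> i) h) \<longlongrightarrow> blinfun_apply m h) G"
proof -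
  define A where "A i = blinfun_apply (\<phi> i)" for i
  define K where "K = (\<Pi>\<^sub>E h\<in>UNIV. {- norm h..norm (h :: 'b)})"
  have "compactin (product_topology (\<lambda>h. euclidean) UNIV) K"
    unfolding K_def compactin_PiE by simp
  then have K: "compact K"
    by (simp add: euclidean_product_topology)
  have "A i \<in> K" if "norm (\<phi> i) \<le> 1" for i
  proof -
    have "\<bar>A i h\<bar> \<le> norm h" for h
      using norm_blinfun[of "\<phi> i" h] mult_right_mono[OF that norm_ge_zero[of h]]
      by (simp add: A_def)
    then show ?thesis
      by (auto simp: K_def PiE_iff abs_le_iff minus_le_iff)
  qed
  with bound have "eventually (\<lambda>f. f \<in> K) (filtermap A F)"
    by (auto simp: eventually_filtermap elim: eventually_mono)
  moreover have "filtermap A F \<noteq> bot"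
    using \<open>F \<noteq> bot\<close> by (simp add: filtermap_bot_iff)
  ultimately obtain g where "g \<in> K" and cluster: "inf (nhds g) (filtermap A F) \<noteq> bot"
    using K unfolding compact_filter by blast
  \<comment> \<open>The cluster point \<open>g\<close> is a limit along a filter on functions; \<open>G\<close> pulls it back to the indices.\<close>
  define G where "G = inf F (filtercomap A (nhds g))"
  have "G \<noteq> bot"
  proof
    assume "G = bot"
    then have "eventually (\<lambda>_. False) G"
      by simp
    then obtain P Q where "eventually P F" "eventually Q (nhds g)" "\<And>i. P i \<Longrightarrow> \<not> Q (A i)"
      unfolding G_def eventually_inf eventually_filtercomap by blast
    then have "eventually (\<lambda>f. \<not> Q f) (filtermap A F)"
      by (auto simp: eventually_filtermap elim: eventually_mono)
    with \<open>eventually Q (nhds g)\<close> have "eventually (\<lambda>_. False) (inf (nhds g) (filtermap A F))"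
      unfolding eventually_inf by blast
    with cluster show False
      by (simp add: trivial_limit_def)
  qed
  have "filterlim A (nhds g) G"
    unfolding G_def by (rule filterlim_mono[OF filterlim_filtercomap order_refl inf.cobounded2])
  then have lim: "((\<lambda>i. \<phi> i h) \<longlongrightarrow> g h) G" for h
    using continuous_on_tendsto_compose[OF continuous_on_product_coordinates, of A g G h]
    by (simp add: A_def)
  have le: "norm (g h) \<le> norm h" for h
    using \<open>g \<in> K\<close> by (auto simp: K_def PiE_iff abs_le_iff minus_le_iff)
  have "bounded_linear g"
  proof (rule bounded_linear_intro)
    fix h k :: 'b and c :: real
    show "g (h + k) = g h + g k"
      using tendsto_unique[OF \<open>G \<noteq> bot\<close> lim[of "h + k"]] tendsto_add[OF lim[of h] lim[of k]]
      by (simp add: blinfun.add_right)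
    show "g (c *\<^sub>R h) = c *\<^sub>R g h"
      using tendsto_unique[OF \<open>G \<noteq> bot\<close> lim[of "c *\<^sub>R h"]] tendsto_scaleR[OF tendsto_const lim[of h], of c]
      by (simp add: blinfun.scaleR_right)
    show "norm (g h) \<le> norm h * 1"
      using le by simp
  qed
  then have g: "blinfun_apply (Blinfun g) = g"
    by (rule bounded_linear_Blinfun_apply)
  show thesis
  proof (rule that)
    show "G \<noteq> bot" by fact
    show "G \<le> F" by (simp add: G_def)
    show "norm (Blinfun g) \<le> 1"
      using le by (intro norm_blinfun_bound) (auto simp: g)
    show "((\<lambda>i. \<phi> i h) \<longlongrightarrow> Blinfun g h) G" for h
      using lim by (simp add: g)
  qed
qed


section \<open>Existence of an invariant mean\<close>

lemma translate_apply [simp]: "translate s h r = h (s * r)"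
  by (simp add: translate.rep_eq)

lemma abs_bcontfun_le: "\<bar>h r\<bar> \<le> norm h" for h :: "'b::topological_space \<Rightarrow>\<^sub>C real"
  using norm_bounded[of h r] by simp

lemma translate_add: "translate s (h + k) = translate s h + translate s k"
  by (rule bcontfun_eqI) simp

lemma translate_scaleR: "translate s (c *\<^sub>R h) = c *\<^sub>R translate s h"
  by (rule bcontfun_eqI) simp

lemma translate_sum: "translate s (\<Sum>i\<in>I. h i) = (\<Sum>i\<in>I. translate s (h i))"
proof -
  have "translate s 0 = 0"
    by (rule bcontfun_eqI) simp
  then show ?thesis
    by (induction I rule: infinite_finite_induct) (auto simp: translate_add)
qed

lemma translate_commute: "translate s (translate t h) = translate t (translate s h)"
  by (rule bcontfun_eqI) (simp add: mult.left_commute)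

lemma translate_translate: "translate s (translate t h) = translate (t * s) h"
  by (rule bcontfun_eqI) (simp add: mult.assoc)

lemma norm_translate_le: "norm (translate s h) \<le> norm h"
  by (rule norm_bound) (simp add: abs_bcontfun_le)

definition translate_average :: "pos_real \<Rightarrow> nat \<Rightarrow> (pos_real \<Rightarrow>\<^sub>C real) \<Rightarrow> (pos_real \<Rightarrow>\<^sub>C real)"
  where "translate_average s n h = (\<Sum>k<n. translate (s ^ k) h) /\<^sub>R real n"

lemma norm_translate_average_le: "norm (translate_average s n h) \<le> norm h"
proof -
  have "norm (\<Sum>k<n. translate (s ^ k) h) \<le> real n * norm h"
    by (rule order_trans[OF norm_sum])
      (use sum_bounded_above[of "{..<n}" "\<lambda>k. norm (translate (s ^ k) h)"] norm_translate_le in force)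
  then have "norm (translate_average s n h) \<le> inverse (real n) * (real n * norm h)"
    unfolding translate_average_def norm_scaleR by (intro mult_mono) auto
  also have "\<dots> \<le> norm h"
    by (cases "n = 0") (auto simp flip: mult.assoc)
  finally show ?thesis .
qed

lemma bounded_linear_translate_average: "bounded_linear (translate_average s n)"
proof (rule bounded_linear_intro)
  show "norm (translate_average s n h) \<le> norm h * 1" for h
    using norm_translate_average_le by simp
qed (simp_all add: translate_average_def translate_add translate_scaleR sum.distrib scaleR_add_right
      scaleR_sum_right mult.commute)

lemma translate_average_commute:
  "translate_average s n (translate t h) = translate t (translate_average s n h)"
  by (simp add: translate_average_def translate_scaleR translate_sum translate_commute[of _ t])

lemma translate_average_const:
  assumes "n > 0"
  shows "translate_average s n (const_bcontfun c) = const_bcontfun c"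
proof -
  have "translate t (const_bcontfun c) = const_bcontfun c" for t
    by (rule bcontfun_eqI) simp
  then show ?thesis
    using assms by (simp add: translate_average_def sum_constant_scaleR del: sum_constant)
qed

text \<open>The sum telescopes: only its first and its last term survive.\<close>

lemma norm_translate_average_diff_le:
  "norm (translate_average s n (translate s h) - translate_average s n h) \<le> 2 * norm h / real n"
proof -
  have "translate_average s n (translate s h) - translate_average s n h
      = (\<Sum>k<n. translate (s ^ Suc k) h - translate (s ^ k) h) /\<^sub>R real n"
    by (simp add: translate_average_def translate_translate sum_subtractf scaleR_diff_right)
  also have "\<dots> = (translate (s ^ n) h - translate (s ^ 0) h) /\<^sub>R real n"
    by (simp only: sum_lessThan_telescope[of "\<lambda>k. translate (s ^ k) h"])
  also have "norm \<dots> \<le> (norm h + norm h) / real n"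
    using norm_triangle_ineq4[of "translate (s ^ n) h" "translate (s ^ 0) h"]
      norm_translate_le[of "s ^ n" h] norm_translate_le[of "s ^ 0" h]
    by (auto simp: divide_inverse mult.commute intro!: mult_left_mono)
  finally show ?thesis
    by simp
qed

text \<open>
  Induction on \<open>S\<close>, starting with the evaluation at \<open>1\<close> and composing with an average over each new
  element. That average commutes with translations and does not increase the norm, so the error bound
  for the elements treated before is kept.
\<close>

lemma almost_invariant_mean_exists:
  assumes "finite S" and "\<epsilon> > 0"
  shows "\<exists>\<phi> :: (pos_real \<Rightarrow>\<^sub>C real) \<Rightarrow>\<^sub>L real. norm \<phi> \<le> 1 \<and> blinfun_apply \<phi> (const_bcontfun 1) = 1 \<and>
    (\<forall>s\<in>S. \<forall>h. \<bar>\<phi> (translate s h) - \<phi> h\<bar> \<le> \<epsilon> * norm h)"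
  using assms(1)
proof induction
  case empty
  have ev: "bounded_linear (\<lambda>h :: pos_real \<Rightarrow>\<^sub>C real. h 1)"
    by (rule bounded_linear_intro[where K = 1]) (auto simp: abs_bcontfun_le)
  show ?case
    by (rule exI[of _ "Blinfun (\<lambda>h. apply_bcontfun h 1)"])
      (auto simp: bounded_linear_Blinfun_apply[OF ev] abs_bcontfun_le intro!: norm_blinfun_bound)
next
  case (insert s S)
  then obtain \<phi> :: "(pos_real \<Rightarrow>\<^sub>C real) \<Rightarrow>\<^sub>L real" where \<phi>: "norm \<phi> \<le> 1" "blinfun_apply \<phi> (const_bcontfun 1) = 1"
    "\<And>t h. t \<in> S \<Longrightarrow> \<bar>\<phi> (translate t h) - \<phi> h\<bar> \<le> \<epsilon> * norm h"
    by auto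
  have \<phi>_le: "\<bar>\<phi> h\<bar> \<le> norm h" for h
    using norm_blinfun[of \<phi> h] mult_right_mono[OF \<phi>(1) norm_ge_zero[of h]] by simp
  obtain n where n: "real n > 2 / \<epsilon>"
    using reals_Archimedean2 by blast
  have "n > 0"
    using order_less_trans[OF divide_pos_pos[OF _ \<open>\<epsilon> > 0\<close>] n] by simp
  have n_eps: "2 * c / real n \<le> \<epsilon> * c" if "c \<ge> 0" for c
  proof -
    have "2 / real n \<le> \<epsilon>"
      using n \<open>n > 0\<close> \<open>\<epsilon> > 0\<close> by (simp add: field_simps)
    from mult_right_mono[OF this that] show ?thesis
      by simp
  qed
  define \<psi> where "\<psi> = \<phi> o\<^sub>L Blinfun (translate_average s n)"
  have \<psi>: "\<psi> h = \<phi> (translate_average s n h)" for h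
    by (simp add: \<psi>_def bounded_linear_Blinfun_apply[OF bounded_linear_translate_average])
  show ?case
  proof (intro exI[of _ \<psi>] conjI ballI allI)
    show "norm \<psi> \<le> 1"
      by (rule norm_blinfun_bound)
        (use order_trans[OF \<phi>_le norm_translate_average_le] in \<open>auto simp: \<psi>\<close>)
    show "\<psi> (const_bcontfun 1) = 1"
      using \<open>n > 0\<close> by (simp add: \<psi> translate_average_const \<phi>(2))
    fix t h
    assume "t \<in> insert s S"
    then consider "t = s" | "t \<in> S"
      by blast
    then show "\<bar>\<psi> (translate t h) - \<psi> h\<bar> \<le> \<epsilon> * norm h"
    proof cases
      case 1
      have "\<bar>\<psi> (translate s h) - \<psi> h\<bar> \<le> 2 * norm h / real n"
        unfolding \<psi> blinfun.diff_right[symmetric]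
        by (rule order_trans[OF \<phi>_le norm_translate_average_diff_le])
      with 1 n_eps[of "norm h"] show ?thesis
        by simp
    next
      case 2
      have "\<bar>\<psi> (translate t h) - \<psi> h\<bar> \<le> \<epsilon> * norm (translate_average s n h)"
        unfolding \<psi> translate_average_commute using \<phi>(3)[OF 2] .
      also have "\<dots> \<le> \<epsilon> * norm h"
        using norm_translate_average_le \<open>\<epsilon> > 0\<close> by (intro mult_left_mono) auto
      finally show ?thesis .
    qed
  qed
qed

theorem invariant_mean_exists: "\<exists>m. invariant_mean m"
proof -
  have "\<forall>S n. \<exists>\<phi> :: (pos_real \<Rightarrow>\<^sub>C real) \<Rightarrow>\<^sub>L real. finite S \<longrightarrow>
      norm \<phi> \<le> 1 \<and> blinfun_apply \<phi> (const_bcontfun 1) = 1 \<and>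
      (\<forall>s\<in>S. \<forall>h. \<bar>\<phi> (translate s h) - \<phi> h\<bar> \<le> inverse (real (Suc n)) * norm h)"
    using almost_invariant_mean_exists by (metis inverse_positive_iff_positive of_nat_0_less_iff zero_less_Suc)
  then obtain \<Phi> :: "pos_real set \<Rightarrow> nat \<Rightarrow> ((pos_real \<Rightarrow>\<^sub>C real) \<Rightarrow>\<^sub>L real)" where
    \<Phi>: "\<And>S n. finite S \<Longrightarrow> norm (\<Phi> S n) \<le> 1" "\<And>S n. finite S \<Longrightarrow> blinfun_apply (\<Phi> S n) (const_bcontfun 1) = 1"
      "\<And>S n s h. finite S \<Longrightarrow> s \<in> S \<Longrightarrow>
         \<bar>\<Phi> S n (translate s h) - \<Phi> S n h\<bar> \<le> inverse (real (Suc n)) * norm h"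
    by metis
  \<comment> \<open>Along \<open>F\<close> the finite set exhausts the group and the error bound tends to zero.\<close>
  define F where "F = (finite_sets_at_top :: pos_real set filter) \<times>\<^sub>F (sequentially :: nat filter)"
  have "F \<noteq> bot"
    by (simp add: F_def prod_filter_eq_bot)
  have contains: "eventually (\<lambda>i. finite (fst i) \<and> s \<in> fst i) F" for s
  proof -
    have "eventually (\<lambda>S. finite S \<and> s \<in> S) finite_sets_at_top"
      unfolding eventually_finite_subsets_at_top by (rule exI[of _ "{s}"]) auto
    from eventually_compose_filterlim[OF this filterlim_fst] show ?thesis
      unfolding F_def .
  qed
  have fin: "eventually (\<lambda>i. finite (fst i)) F"
    by (rule eventually_mono[OF contains[of 1]]) auto
  define \<phi> where "\<phi> i = \<Phi> (fst i) (snd i)" for i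
  have "eventually (\<lambda>i. norm (\<phi> i) \<le> 1) F"
    using fin by eventually_elim (simp add: \<phi>_def \<Phi>)
  then obtain m G where G: "G \<noteq> bot" "G \<le> F" and m: "norm m \<le> 1"
    and lim: "\<And>h. ((\<lambda>i. blinfun_apply (\<phi> i) h) \<longlongrightarrow> blinfun_apply m h) G"
    by (rule dual_ball_weak_star_cluster[OF \<open>F \<noteq> bot\<close>]) (rule that)
  have m1: "m (const_bcontfun 1) = 1"
  proof (rule tendsto_unique[OF \<open>G \<noteq> bot\<close> lim])
    have "eventually (\<lambda>i. \<phi> i (const_bcontfun 1) = 1) G"
      using filter_leD[OF G(2) fin] by eventually_elim (simp add: \<phi>_def \<Phi>)
    then show "((\<lambda>i. \<phi> i (const_bcontfun 1)) \<longlongrightarrow> 1) G"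
      by (rule tendsto_eventually)
  qed
  have inv: "m (translate s h) = m h" for s h
  proof -
    have "filterlim snd sequentially G"
      by (rule filterlim_mono[OF filterlim_snd order_refl G(2)[unfolded F_def]])
    then have "((\<lambda>i. inverse (real (Suc (snd i))) * norm h) \<longlongrightarrow> 0 * norm h) G"
      by (intro tendsto_mult tendsto_const filterlim_compose[OF LIMSEQ_inverse_real_of_nat])
    moreover have "eventually (\<lambda>i. norm (\<phi> i (translate s h) - \<phi> i h)
        \<le> inverse (real (Suc (snd i))) * norm h) G"
      using filter_leD[OF G(2) contains[of s]]
    proof eventually_elim
      case (elim i)
      then show ?case
        using \<Phi>(3)[of "fst i" s "snd i" h] unfolding \<phi>_def real_norm_def by blast
    qed
    ultimately have "((\<lambda>i. \<phi> i (translate s h) - \<phi> i h) \<longlongrightarrow> 0) G"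
      unfolding mult_zero_left by (rule Lim_null_comparison[rotated])
    from tendsto_unique[OF \<open>G \<noteq> bot\<close> this tendsto_diff[OF lim lim]] show ?thesis
      by simp
  qed
  have "norm (const_bcontfun 1 :: pos_real \<Rightarrow>\<^sub>C real) \<le> 1"
    by (rule norm_bound) simp
  then have "norm m \<ge> 1"
    using norm_blinfun[of m "const_bcontfun 1"] m1
      mult_left_mono[of "norm (const_bcontfun 1 :: pos_real \<Rightarrow>\<^sub>C real)" 1 "norm m"] by simp
  with m m1 inv have "invariant_mean m"
    by (simp add: invariant_mean_def)
  then show ?thesis ..
qed


section \<open>Averaging a Lipschitz function over its dilations\<close>

lemma dilation_orbit_apply [simp]:
  "dilation_orbit f x r = real_of_pos r * lip0_apply f (x /\<^sub>R real_of_pos r)"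
  by (simp add: dilation_orbit.rep_eq)

lemma dilation_orbit_zero [simp]: "dilation_orbit f 0 = 0"
  by (rule bcontfun_eqI) simp

lemma dilation_orbit_add: "dilation_orbit (f + g) x = dilation_orbit f x + dilation_orbit g x"
  by (rule bcontfun_eqI) (simp add: algebra_simps)

lemma dilation_orbit_scaleR_left: "dilation_orbit (c *\<^sub>R f) x = c *\<^sub>R dilation_orbit f x"
  by (rule bcontfun_eqI) simp

text \<open>The factor \<open>r\<close> compensates the contraction \<open>x / r\<close>, uniformly in \<open>r\<close>.\<close>

lemma norm_dilation_orbit_diff_le:
  "norm (dilation_orbit f x - dilation_orbit f y) \<le> norm f * dist x y"
proof (rule norm_bound)
  fix r
  define \<rho> where "\<rho> = real_of_pos r"
  have "\<rho> > 0"
    by (simp add: \<rho>_def)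
  have "\<bar>f (x /\<^sub>R \<rho>) - f (y /\<^sub>R \<rho>)\<bar> \<le> norm f * (dist x y / \<rho>)"
    using lipschitz_onD[OF lipschitz_on_norm_lip0, of "x /\<^sub>R \<rho>" "y /\<^sub>R \<rho>" f] \<open>\<rho> > 0\<close>
    by (simp add: dist_real_def dist_scaleR divide_inverse mult.commute dist_norm
        flip: scaleR_diff_right)
  from mult_left_mono[OF this, of \<rho>] \<open>\<rho> > 0\<close>
  show "norm ((dilation_orbit f x - dilation_orbit f y) r) \<le> norm f * dist x y"
    by (simp add: abs_mult flip: \<rho>_def right_diff_distrib)
qed

text \<open>
  With \<open>q = r / t\<close> this is the identity \<open>r f(t x / r) = t (q f(x / q))\<close>: a dilation of the
  argument is a translation of the parameter.
\<close>

lemma dilation_orbit_scaleR: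
  "dilation_orbit f (real_of_pos t *\<^sub>R x) = real_of_pos t *\<^sub>R translate (inverse t) (dilation_orbit f x)"
  by (rule bcontfun_eqI) (simp add: times_pos_real.rep_eq inverse_pos_real.rep_eq mult.commute)

lemma dilation_orbit_ph:
  assumes "f \<in> lip0_ph"
  shows "dilation_orbit f x = const_bcontfun (f x)"
proof (rule bcontfun_eqI)
  fix r
  have "f (x /\<^sub>R real_of_pos r) = inverse (real_of_pos r) * f x"
    using assms real_of_pos_pos[of r] unfolding lip0_ph_def by (auto simp: less_imp_le)
  then show "dilation_orbit f x r = const_bcontfun (f x) r"
    by simp
qed

context
  fixes m :: "(pos_real \<Rightarrow>\<^sub>C real) \<Rightarrow>\<^sub>L real"
  assumes m: "invariant_mean m"
begin

lemma mean_abs_le: "\<bar>m h\<bar> \<le> norm h"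
  using m norm_blinfun[of m h] by (simp add: invariant_mean_def)

lemma mean_const: "m (const_bcontfun c) = c"
proof -
  have "const_bcontfun c = c *\<^sub>R (const_bcontfun 1 :: pos_real \<Rightarrow>\<^sub>C real)"
    by (rule bcontfun_eqI) simp
  then show ?thesis
    using m by (simp add: invariant_mean_def blinfun.scaleR_right)
qed

lemma lipschitz_on_dilation_mean: "(norm f)-lipschitz_on UNIV (\<lambda>x. m (dilation_orbit f x))"
proof (rule lipschitz_onI)
  show "dist (m (dilation_orbit f x)) (m (dilation_orbit f y)) \<le> norm f * dist x y" for x y
    unfolding dist_real_def blinfun.diff_right[symmetric]
    by (rule order_trans[OF mean_abs_le norm_dilation_orbit_diff_le])
qed simp

definition dilation_mean :: "'a::real_normed_vector lip0 \<Rightarrow> 'a lip0" where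
  "dilation_mean f = Lip0 (\<lambda>x. m (dilation_orbit f x))"

lemma dilation_mean_apply: "dilation_mean f x = m (dilation_orbit f x)"
  unfolding dilation_mean_def
  by (subst Lip0_inverse) (use lipschitz_on_dilation_mean in auto)

lemma norm_dilation_mean_le: "norm (dilation_mean f) \<le> norm f"
  by (rule norm_lip0_le) (use lipschitz_on_dilation_mean in \<open>simp add: dilation_mean_apply\<close>)

lemma bounded_linear_dilation_mean: "bounded_linear dilation_mean"
proof (rule bounded_linear_intro)
  show "norm (dilation_mean f) \<le> norm f * 1" for f :: "'a lip0"
    using norm_dilation_mean_le by simp
qed (auto intro!: lip0_eqI simp: dilation_mean_apply dilation_orbit_add dilation_orbit_scaleR_left
      blinfun.add_right blinfun.scaleR_right)

lemma dilation_mean_ph: "dilation_mean f \<in> lip0_ph"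
  unfolding lip0_ph_def
proof (intro CollectI allI impI)
  fix t :: real and x
  assume "t \<ge> 0"
  show "dilation_mean f (t *\<^sub>R x) = t * dilation_mean f x"
  proof (cases "t = 0")
    case False
    with \<open>t \<ge> 0\<close> have "real_of_pos (Pos t) = t"
      by (simp add: Pos_inverse)
    with dilation_orbit_scaleR[of f "Pos t" x] m show ?thesis
      by (simp add: dilation_mean_apply blinfun.scaleR_right invariant_mean_def)
  qed simp
qed

lemma dilation_mean_fixes_ph: "f \<in> lip0_ph \<Longrightarrow> dilation_mean f = f"
  by (rule lip0_eqI) (simp add: dilation_mean_apply dilation_orbit_ph mean_const)

end

lemma nonzero_lip0_ph_exists:
  assumes "\<exists>x :: 'a::real_normed_vector. x \<noteq> 0"
  shows "\<exists>f :: 'a lip0. f \<in> lip0_ph \<and> f \<noteq> 0"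
proof -
  have "1-lipschitz_on UNIV (norm :: 'a \<Rightarrow> real)"
    by (rule lipschitz_onI) (auto simp: dist_norm norm_triangle_ineq3)
  then have norm: "lip0_apply (Lip0 norm) = (norm :: 'a \<Rightarrow> real)"
    by (intro Lip0_inverse) auto
  obtain x :: 'a where "x \<noteq> 0"
    using assms by blast
  then have "Lip0 norm x \<noteq> (0 :: 'a lip0) x"
    by (simp add: norm)
  then have "(Lip0 norm :: 'a lip0) \<noteq> 0"
    by auto
  moreover have "(Lip0 norm :: 'a lip0) \<in> lip0_ph"
    by (simp add: lip0_ph_def norm)
  ultimately show ?thesis
    by blast
qed

theorem theorem4p1:
  assumes "\<exists>x :: 'a::banach. x \<noteq> 0"
  shows "(\<exists>m. invariant_mean m)
    \<and> (\<forall>m. invariant_mean m \<longrightarrow>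
          (\<exists>P :: 'a lip0 \<Rightarrow>\<^sub>L 'a lip0.
             projection_onto lip0_ph P \<and> norm P = 1
             \<and> (\<forall>f x. lip0_apply (P f) x = m (dilation_orbit f x))))
    \<and> one_complemented (lip0_ph :: 'a lip0 set)"
proof -
  have projection: "\<exists>P :: 'a lip0 \<Rightarrow>\<^sub>L 'a lip0. projection_onto lip0_ph P \<and> norm P = 1
      \<and> (\<forall>f x. lip0_apply (P f) x = m (dilation_orbit f x))" if m: "invariant_mean m" for m
  proof -
    define P :: "'a lip0 \<Rightarrow>\<^sub>L 'a lip0" where "P = Blinfun (dilation_mean m)"
    have P: "blinfun_apply P = dilation_mean m"
      unfolding P_def by (rule bounded_linear_Blinfun_apply[OF bounded_linear_dilation_mean[OF m]])
    have "P o\<^sub>L P = P"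
      by (rule blinfun_eqI) (simp add: P dilation_mean_fixes_ph[OF m] dilation_mean_ph[OF m])
    moreover have "range P = lip0_ph"
      unfolding P
      by (auto simp: dilation_mean_ph[OF m] image_iff intro!: dilation_mean_fixes_ph[OF m, symmetric])
    moreover have "norm P \<le> 1"
      by (rule norm_blinfun_bound) (auto simp: P norm_dilation_mean_le[OF m])
    moreover have "norm P \<ge> 1"
    proof -
      obtain f :: "'a lip0" where f: "f \<in> lip0_ph" "f \<noteq> 0"
        using nonzero_lip0_ph_exists[OF assms] by blast
      have "norm f \<le> norm P * norm f"
        using norm_blinfun[of P f] by (simp add: P dilation_mean_fixes_ph[OF m f(1)])
      then show ?thesis
        using f(2) by simp
    qed
    ultimately show ?thesis
      by (intro exI[of _ P]) (auto simp: projection_onto_def P dilation_mean_apply[OF m])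
  qed
  obtain m where "invariant_mean m"
    using invariant_mean_exists by blast
  from projection[OF this] have "one_complemented (lip0_ph :: 'a lip0 set)"
    unfolding one_complemented_def by force
  with invariant_mean_exists projection show ?thesis
    by blast
qed

end
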